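(* Assume the standing assumption, the strong pseudomonotonicity assumption, the state-Lipschitz assumption on $h$, the time regularity assumption and the Lipschitz assumption on $f$ stated in the context. Let $(x_i,u_i)$ be mild solution pairs corresponding to initial data $x_{0,i}\in H$, $i=1,2$. Let $M\ge1$ and $\omega\in\mathbb R$ be constants with $\|e^{At}\|\le Me^{\omega t}$ for all $t\ge0$, let $L:=\alpha_h\|P^{-1}\|/\gamma$ and $\tilde L:=\alpha_f+\beta_fL$. Then, for every $t\in[0,T]$, $$\|x_1(t)-x_2(t)\|\le Me^{(\omega+M\tilde L)t}\|x_{0,1}-x_{0,2}\|,\qquad \|u_1(t)-u_2(t)\|\le LMe^{(\omega+M\tilde L)t}\|x_{0,1}-x_{0,2}\|.$$ Consequently, $$\|x_1-x_2\|_{C([0,T];H)}\le Me^{(\omega+M\tilde L)_+T}\|x_{0,1}-x_{0,2}\|,\qquad \|u_1-u_2\|_{C([0,T];H)}\le LMe^{(\omega+M\tilde L)_+T}\|x_{0,1}-x_{0,2}\|.$$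
   Context: Let $H$ be a separable real Hilbert space with inner product $\langle\cdot,\cdot\rangle$ and norm $\|\cdot\|$, $\mathbb B_R(0)$ its closed ball of radius $R$ centered at $0$, and $T>0$. $\|v\|_{C([0,T];H)}:=\max_{t\in[0,T]}\|v(t)\|$ and $r_+:=\max\{r,0\}$. For nonempty closed convex $C\subset H$, $\mathrm{proj}_C$ is the metric projection onto $C$, and $N_C(y)=\{\xi\in H:\langle\xi,v-y\rangle\le0\ \forall v\in C\}$ if $y\in C$, $N_C(y)=\emptyset$ otherwise. A mapping $G:[0,T]\times X\to H$ ($X$ a separable metric space) is Carathéodory if $t\mapsto G(t,z)$ is strongly measurable for every $z\in X$, and $z\mapsto G(t,z)$ is continuous for almost every $t\in[0,T]$. Standing assumption: (i) $A:D(A)\subset H\to H$ is the infinitesimal generator of a strongly continuous semigroup $\{e^{At}\}_{t\ge0}$ on $H$; (ii) $P:H\to H$ is linear, bounded, self-adjoint and coercive (so $P$ is invertible with bounded inverse and $P^{-1}$ is strongly monotone); (iii) $K:[0,T]\rightrightarrows H$ is a set-valued mapping with nonempty, closed, convex values; (iv) $f,h:[0,T]\times H\times H\to H$ are Carathéodory mappings (with $X=H\times H$), and $t\mapsto f(t,0,0)$ belongs to $L^1(0,T;H)$. For $t\in[0,T]$, $x\in H$ define $F_{t,x}:H\to H$ by $F_{t,x}(y):=P^{-1}y-h(t,x,P^{-1}y)$. An operator $F:H\to H$ is strongly pseudomonotone on $C\subset H$ with modulus $m>0$ if for all $y,z\in C$: $\langle F(y),z-y\rangle\ge0$ implies $\langle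 F(z),z-y\rangle\ge m\|z-y\|^2$. Strong pseudomonotonicity assumption: there are $\gamma>0$ and $L_F>0$ such that for every $t\in[0,T]$ and every $x\in H$, $F_{t,x}$ is strongly pseudomonotone on $K(t)$ with modulus $\gamma$ and Lipschitz continuous on $H$ with modulus $L_F$. State-Lipschitz assumption on $h$: there exists $\alpha_h>0$ such that $\|h(t,x_1,u)-h(t,x_2,u)\|\le\alpha_h\|x_1-x_2\|$ for all $t\in[0,T]$, $x_1,x_2,u\in H$. Time regularity assumption: (i) for every $R\ge0$ there is a continuous $\omega_{K,R}:\mathbb R_+\to\mathbb R_+$ with $\lim_{r\to0^+}\omega_{K,R}(r)=0$ and $\|\mathrm{proj}_{K(t_1)}(z)-\mathrm{proj}_{K(t_2)}(z)\|\le\omega_{K,R}(|t_1-t_2|)$ for all $t_1,t_2\in[0,T]$, $z\in\mathbb B_R(0)$; (ii) for every $R\ge0$ there is a continuous $\omega_{h,R}:\mathbb R_+\to\mathbb R_+$ with $\lim_{r\to0^+}\omega_{h,R}(r)=0$ and $\|h(t_1,x,u)-h(t_2,x,u)\|\le\omega_{h,R}(|t_1-t_2|)$ for all $t_1,t_2\in[0,T]$, $x,u\in\mathbb B_R(0)$. Lipschitz assumption on $f$: there are $\alpha_f>0$, $\beta_f>0$ such that $\|f(t,x_1,u_1)-f(t,x_2,u_2)\|\le\alpha_f\|x_1-x_2\|+\beta_f\|u_1-u_2\|$ for all $t\in[0,T]$, $x_1,x_2,u_1,u_2\in H$. A mild solution pair with initial datum $x_0\in H$ is a pair $(x,u)\in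 C([0,T];H)\times C([0,T];H)$ with $x(t)=e^{At}x_0+\int_0^te^{A(t-s)}f(s,x(s),u(s))\,ds$ for all $t\in[0,T]$ and $u(t)\in h(t,x(t),u(t))-N_{K(t)}(Pu(t))$ for a.e. $t\in(0,T)$. *)

theory Defs
  imports "HOL-Analysis.Analysis"
begin

text \<open>
  A separable real Hilbert space is a type \<open>'h\<close> of sort
  \<open>{real_inner, banach, second_countable_topology}\<close> (for metric spaces, separable and
  second countable coincide). Time-dependent data are functions on all of \<open>real\<close>; every
  hypothesis about them is restricted to \<open>{0..T}\<close>, so their values elsewhere are irrelevant.
\<close>

section \<open>Convex analysis\<close>

text \<open>
  The library's \<open>closest_point\<close> is restricted to \<open>heine_borel\<close> spaces, i.e. finite dimension.
  The description below is well defined on nonempty closed convex subsets of a Hilbert space.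
\<close>

definition metric_proj :: "'h::real_inner set \<Rightarrow> 'h \<Rightarrow> 'h" where
  "metric_proj C z = (THE y. y \<in> C \<and> (\<forall>v\<in>C. dist z y \<le> dist z v))"

definition normal_cone :: "'h::real_inner set \<Rightarrow> 'h \<Rightarrow> 'h set" where
  "normal_cone C y = (if y \<in> C then {\<xi>. \<forall>v\<in>C. inner \<xi> (v - y) \<le> 0} else {})"

definition strongly_pseudomonotone_on :: "real \<Rightarrow> 'h::real_inner set \<Rightarrow> ('h \<Rightarrow> 'h) \<Rightarrow> bool" where
  "strongly_pseudomonotone_on m C F \<longleftrightarrow> m > 0 \<and>
     (\<forall>y\<in>C. \<forall>z\<in>C. inner (F y) (z - y) \<ge> 0 \<longrightarrow> inner (F z) (z - y) \<ge> m * (norm (z - y))\<^sup>2)"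

definition self_adjoint_op :: "('h::real_inner \<Rightarrow> 'h) \<Rightarrow> bool" where
  "self_adjoint_op P \<longleftrightarrow> (\<forall>x y. inner (P x) y = inner x (P y))"

definition coercive_op :: "('h::real_inner \<Rightarrow> 'h) \<Rightarrow> bool" where
  "coercive_op P \<longleftrightarrow> (\<exists>c>0. \<forall>x. inner (P x) x \<ge> c * (norm x)\<^sup>2)"

section \<open>Strongly continuous semigroups and their generators\<close>

definition C0_semigroup :: "(real \<Rightarrow> 'h::real_normed_vector \<Rightarrow> 'h) \<Rightarrow> bool" where
  "C0_semigroup S \<longleftrightarrow>
     (\<forall>t\<ge>0. bounded_linear (S t)) \<and>
     S 0 = id \<and>
     (\<forall>s\<ge>0. \<forall>t\<ge>0. S (s + t) = S s \<circ> S t) \<and>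
     (\<forall>x. ((\<lambda>t. S t x) \<longlongrightarrow> x) (at_right 0))"

text \<open>
  The unbounded operator \<open>A : D(A) \<rightarrow> H\<close> is represented by a total function \<open>A\<close> together with
  its domain \<open>D\<close>; the values of \<open>A\<close> outside \<open>D\<close> are irrelevant. The semigroup \<open>S\<close>,
  with \<open>S t\<close> in the role of \<open>e\<^sup>A\<^sup>t\<close>, is uniquely determined on \<open>t \<ge> 0\<close> by \<open>A\<close> and \<open>D\<close>.
\<close>

definition generates_C0_semigroup ::
  "('h::real_normed_vector \<Rightarrow> 'h) \<Rightarrow> 'h set \<Rightarrow> (real \<Rightarrow> 'h \<Rightarrow> 'h) \<Rightarrow> bool" where
  "generates_C0_semigroup A D S \<longleftrightarrow>
     C0_semigroup S \<and>
     D = {x. \<exists>y. ((\<lambda>t. (S t x - x) /\<^sub>R t) \<longlongrightarrow> y) (at_right 0)} \<and>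
     (\<forall>x\<in>D. ((\<lambda>t. (S t x - x) /\<^sub>R t) \<longlongrightarrow> A x) (at_right 0))"

section \<open>Assumptions on the data\<close>

text \<open>
  Since the target is separable and Lebesgue measure is complete, strong measurability is the
  same as Borel measurability with respect to the Lebesgue sigma-algebra.
\<close>

definition caratheodory ::
  "real \<Rightarrow> (real \<Rightarrow> 'z::{metric_space, second_countable_topology}
     \<Rightarrow> 'h::{real_inner, banach, second_countable_topology}) \<Rightarrow> bool" where
  "caratheodory T G \<longleftrightarrow>
     (\<forall>z. (\<lambda>t. G t z) \<in> borel_measurable (lebesgue_on {0..T})) \<and>
     (AE t in lebesgue_on {0..T}. continuous_on UNIV (G t))"

definition standing_assumption ::
  "real \<Rightarrow> ('h::{real_inner, banach, second_countable_topology} \<Rightarrow> 'h) \<Rightarrow> 'h set \<Rightarrow>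
   (real \<Rightarrow> 'h \<Rightarrow> 'h) \<Rightarrow> ('h \<Rightarrow> 'h) \<Rightarrow> (real \<Rightarrow> 'h set) \<Rightarrow>
   (real \<Rightarrow> 'h \<Rightarrow> 'h \<Rightarrow> 'h) \<Rightarrow> (real \<Rightarrow> 'h \<Rightarrow> 'h \<Rightarrow> 'h) \<Rightarrow> bool" where
  "standing_assumption T A D S P K f h \<longleftrightarrow>
     generates_C0_semigroup A D S \<and>
     bounded_linear P \<and> self_adjoint_op P \<and> coercive_op P \<and>
     (\<forall>t\<in>{0..T}. K t \<noteq> {} \<and> closed (K t) \<and> convex (K t)) \<and>
     caratheodory T (\<lambda>t (x, u). f t x u) \<and>
     caratheodory T (\<lambda>t (x, u). h t x u) \<and>
     integrable (lebesgue_on {0..T}) (\<lambda>t. f t 0 0)"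

text \<open>\<open>inv P\<close> is a genuine inverse, as a bounded coercive operator is bijective.\<close>

definition F_op ::
  "('h::real_inner \<Rightarrow> 'h) \<Rightarrow> (real \<Rightarrow> 'h \<Rightarrow> 'h \<Rightarrow> 'h) \<Rightarrow> real \<Rightarrow> 'h \<Rightarrow> 'h \<Rightarrow> 'h" where
  "F_op P h t x y = inv P y - h t x (inv P y)"

definition strong_pseudomonotonicity_assumption ::
  "real \<Rightarrow> ('h::real_inner \<Rightarrow> 'h) \<Rightarrow> (real \<Rightarrow> 'h set) \<Rightarrow> (real \<Rightarrow> 'h \<Rightarrow> 'h \<Rightarrow> 'h) \<Rightarrow>
   real \<Rightarrow> real \<Rightarrow> bool" where
  "strong_pseudomonotonicity_assumption T P K h \<gamma> L\<^sub>F \<longleftrightarrow>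
     \<gamma> > 0 \<and> L\<^sub>F > 0 \<and>
     (\<forall>t\<in>{0..T}. \<forall>x.
        strongly_pseudomonotone_on \<gamma> (K t) (F_op P h t x) \<and>
        L\<^sub>F-lipschitz_on UNIV (F_op P h t x))"

definition state_lipschitz_assumption ::
  "real \<Rightarrow> (real \<Rightarrow> 'h::real_inner \<Rightarrow> 'h \<Rightarrow> 'h) \<Rightarrow> real \<Rightarrow> bool" where
  "state_lipschitz_assumption T h \<alpha>\<^sub>h \<longleftrightarrow>
     \<alpha>\<^sub>h > 0 \<and>
     (\<forall>t\<in>{0..T}. \<forall>x\<^sub>1 x\<^sub>2 u. norm (h t x\<^sub>1 u - h t x\<^sub>2 u) \<le> \<alpha>\<^sub>h * norm (x\<^sub>1 - x\<^sub>2))"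

definition modulus_fun :: "(real \<Rightarrow> real) \<Rightarrow> bool" where
  "modulus_fun w \<longleftrightarrow>
     continuous_on {0..} w \<and> (\<forall>r\<ge>0. w r \<ge> 0) \<and> (w \<longlongrightarrow> 0) (at_right 0)"

definition time_regularity_assumption ::
  "real \<Rightarrow> (real \<Rightarrow> 'h::real_inner set) \<Rightarrow> (real \<Rightarrow> 'h \<Rightarrow> 'h \<Rightarrow> 'h) \<Rightarrow> bool" where
  "time_regularity_assumption T K h \<longleftrightarrow>
     (\<forall>R\<ge>0. \<exists>w. modulus_fun w \<and>
        (\<forall>t\<^sub>1\<in>{0..T}. \<forall>t\<^sub>2\<in>{0..T}. \<forall>z\<in>cball 0 R.
           norm (metric_proj (K t\<^sub>1) z - metric_proj (K t\<^sub>2) z) \<le> w \<bar>t\<^sub>1 - t\<^sub>2\<bar>)) \<and>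
     (\<forall>R\<ge>0. \<exists>w. modulus_fun w \<and>
        (\<forall>t\<^sub>1\<in>{0..T}. \<forall>t\<^sub>2\<in>{0..T}. \<forall>x\<in>cball 0 R. \<forall>u\<in>cball 0 R.
           norm (h t\<^sub>1 x u - h t\<^sub>2 x u) \<le> w \<bar>t\<^sub>1 - t\<^sub>2\<bar>))"

definition f_lipschitz_assumption ::
  "real \<Rightarrow> (real \<Rightarrow> 'h::real_inner \<Rightarrow> 'h \<Rightarrow> 'h) \<Rightarrow> real \<Rightarrow> real \<Rightarrow> bool" where
  "f_lipschitz_assumption T f \<alpha>\<^sub>f \<beta>\<^sub>f \<longleftrightarrow>
     \<alpha>\<^sub>f > 0 \<and> \<beta>\<^sub>f > 0 \<and>
     (\<forall>t\<in>{0..T}. \<forall>x\<^sub>1 x\<^sub>2 u\<^sub>1 u\<^sub>2.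
        norm (f t x\<^sub>1 u\<^sub>1 - f t x\<^sub>2 u\<^sub>2) \<le> \<alpha>\<^sub>f * norm (x\<^sub>1 - x\<^sub>2) + \<beta>\<^sub>f * norm (u\<^sub>1 - u\<^sub>2))"

section \<open>Mild solution pairs\<close>

text \<open>
  Integrability of the integrand in the mild formula is not demanded: it follows from the
  standing assumption, the Lipschitz assumption on \<open>f\<close> and the continuity of \<open>x\<close> and \<open>u\<close>, so
  under those assumptions the Bochner integral never takes its default value.
\<close>

definition mild_solution_pair ::
  "real \<Rightarrow> (real \<Rightarrow> 'h::{real_inner, banach, second_countable_topology} \<Rightarrow> 'h) \<Rightarrow> ('h \<Rightarrow> 'h) \<Rightarrow>
   (real \<Rightarrow> 'h set) \<Rightarrow> (real \<Rightarrow> 'h \<Rightarrow> 'h \<Rightarrow> 'h) \<Rightarrow> (real \<Rightarrow> 'h \<Rightarrow> 'h \<Rightarrow> 'h) \<Rightarrow>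
   'h \<Rightarrow> (real \<Rightarrow> 'h) \<Rightarrow> (real \<Rightarrow> 'h) \<Rightarrow> bool" where
  "mild_solution_pair T S P K f h x\<^sub>0 x u \<longleftrightarrow>
     continuous_on {0..T} x \<and> continuous_on {0..T} u \<and>
     (\<forall>t\<in>{0..T}. x t = S t x\<^sub>0 + (LINT s|lebesgue_on {0..t}. S (t - s) (f s (x s) (u s)))) \<and>
     (AE t in lebesgue_on {0<..<T}.
        u t \<in> (\<lambda>\<xi>. h t (x t) (u t) - \<xi>) ` normal_cone (K t) (P (u t)))"

text \<open>
  The maximum of \<open>norm (v t)\<close> over \<open>{0..T}\<close>, for \<open>v\<close> continuous there; \<open>Max\<close> is
  only meaningful for finite sets.
\<close>

definition C_norm :: "real \<Rightarrow> (real \<Rightarrow> 'h::real_normed_vector) \<Rightarrow> real" where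
  "C_norm T v = (GREATEST r. r \<in> (\<lambda>t. norm (v t)) ` {0..T})"

end

theory Submission
  imports Defs
begin

text \<open>
  Putting \<open>y\<^sub>i = P u\<^sub>i\<close> turns the inclusion into the variational inequality
  \<open>\<langle>F\<^sub>t\<^sub>,\<^sub>x\<^sub>i(y\<^sub>i), v - y\<^sub>i\<rangle> \<ge> 0\<close> on \<open>K(t)\<close>. Strong pseudomonotonicity
  makes its solution Lipschitz in \<open>x\<close>, so \<open>\<parallel>u\<^sub>1 - u\<^sub>2\<parallel> \<le> L \<parallel>x\<^sub>1 - x\<^sub>2\<parallel>\<close> for almost
  every time and, by continuity, for every time. Inserting this into the difference of the two mild
  formulas, Gronwall's inequality for \<open>\<phi>(t) = e\<^sup>-\<^sup>\<omega>\<^sup>t \<parallel>x\<^sub>1(t) - x\<^sub>2(t)\<parallel>\<close> gives the estimate.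
\<close>

section \<open>Bounded invertibility of coercive operators\<close>

text \<open>Cauchy-Schwarz in the coercivity inequality, then division by \<open>norm x\<close>. The
  bound yields injectivity of \<open>P\<close> and later controls its inverse.\<close>

lemma coercive_op_lower_bound:
  fixes P :: "'h::real_inner \<Rightarrow> 'h"
  assumes "coercive_op P"
  obtains c where "c > 0" "\<And>x. c * norm x \<le> norm (P x)"
proof -
  obtain c where c: "c > 0" "\<And>x. c * (norm x)\<^sup>2 \<le> inner (P x) x"
    using assms unfolding coercive_op_def by auto
  have "c * norm x \<le> norm (P x)" for x
  proof (cases "x = 0")
    case False
    have "c * norm x * norm x \<le> norm (P x) * norm x"
      using order_trans[OF c(2) norm_cauchy_schwarz] by (simp add: power2_eq_square mult.assoc)
    then show ?thesis using False by simp
  qed simp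
  with c(1) show thesis by (rule that)
qed

text \<open>Surjectivity: for small \<open>r > 0\<close> the map \<open>x \<mapsto> x - r (P x - b)\<close> is a contraction.\<close>

lemma bij_coercive_op:
  fixes P :: "'h::{real_inner, banach} \<Rightarrow> 'h"
  assumes P: "bounded_linear P" and "coercive_op P"
  shows "bij P"
proof (rule bijI)
  interpret bounded_linear P by fact
  obtain c where c: "c > 0" "\<And>x. c * norm x \<le> norm (P x)"
    using coercive_op_lower_bound[OF assms(2)] by blast
  show "inj P"
    unfolding inj_iff_eq_0
  proof (intro allI impI)
    fix x assume "P x = 0"
    then show "x = 0" using c by (metis norm_zero mult_le_0_iff norm_le_zero_iff not_le)
  qed
  obtain c where c: "c > 0" "\<And>x. c * (norm x)\<^sup>2 \<le> inner (P x) x"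
    using assms(2) unfolding coercive_op_def by auto
  obtain B where B: "B > 0" "\<And>x. norm (P x) \<le> norm x * B"
    using pos_bounded by auto
  \<comment> \<open>This \<open>r\<close> minimises
    \<open>1 - 2 * r * c + r\<^sup>2 * B\<^sup>2\<close>, with minimum
    \<open>1 - c\<^sup>2 / B\<^sup>2\<close>.\<close>
  define r where "r = c / B\<^sup>2"
  \<comment> \<open>The \<open>max 0\<close> keeps the radicand nonnegative without comparing
    \<open>c\<close> with \<open>B\<close>; on the zero space \<open>c\<close> may exceed
    \<open>B\<close>.\<close>
  define q where "q = sqrt (max 0 (1 - c\<^sup>2 / B\<^sup>2))"
  have r: "r > 0" unfolding r_def using c(1) B(1) by simp
  have q: "0 \<le> q" "q < 1" unfolding q_def using c(1) B(1) by (auto simp: real_less_lsqrt)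
  have contr: "norm (x - r *\<^sub>R P x) \<le> q * norm x" for x
  proof -
    have "(norm (x - r *\<^sub>R P x))\<^sup>2 = (norm x)\<^sup>2 - 2 * r * inner (P x) x + r\<^sup>2 * (norm (P x))\<^sup>2"
      unfolding power2_norm_eq_inner
      by (simp add: inner_diff_left inner_diff_right inner_commute power2_eq_square algebra_simps)
    also have "\<dots> \<le> (norm x)\<^sup>2 - 2 * r * (c * (norm x)\<^sup>2) + r\<^sup>2 * (norm x * B)\<^sup>2"
      using c(2)[of x] B r by (intro add_mono diff_mono mult_left_mono power_mono) auto
    also have "\<dots> = (1 - c\<^sup>2 / B\<^sup>2) * (norm x)\<^sup>2"
      using B(1) by (simp add: r_def field_simps power2_eq_square)
    also have "\<dots> \<le> q\<^sup>2 * (norm x)\<^sup>2"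
      by (intro mult_right_mono) (auto simp: q_def)
    finally show ?thesis
      by (rule power2_le_imp_le[OF _ mult_nonneg_nonneg[OF q(1) norm_ge_zero], unfolded power_mult_distrib])
  qed
  show "surj P"
    unfolding surj_def
  proof
    fix b
    \<comment> \<open>As \<open>r\<close> is nonzero, the fixed points are exactly the solutions of
      \<open>P x = b\<close>.\<close>
    have "\<exists>!x. x - r *\<^sub>R (P x - b) = x"
    proof (rule banach_fix_type[OF q], intro allI)
      fix x y
      have "x - r *\<^sub>R (P x - b) - (y - r *\<^sub>R (P y - b)) = (x - y) - r *\<^sub>R P (x - y)"
        by (simp add: diff scaleR_diff_right)
      then show "dist (x - r *\<^sub>R (P x - b)) (y - r *\<^sub>R (P y - b)) \<le> q * dist x y"
        using contr[of "x - y"] by (simp only: dist_norm)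
    qed
    then show "\<exists>x. b = P x" using r by auto
  qed
qed

text \<open>The lower bound at \<open>inv P x\<close> gives the constant \<open>1 / c\<close>.
  Boundedness makes \<open>onorm (inv P)\<close>, which enters \<open>L\<close>, a genuine operator
  norm.\<close>

lemma bounded_linear_inv_coercive_op:
  fixes P :: "'h::{real_inner, banach} \<Rightarrow> 'h"
  assumes P: "bounded_linear P" and "coercive_op P"
  shows "bounded_linear (inv P)"
proof -
  interpret bounded_linear P by fact
  obtain c where c: "c > 0" "\<And>x. c * norm x \<le> norm (P x)"
    using coercive_op_lower_bound[OF assms(2)] by blast
  have bij: "bij P" by (rule bij_coercive_op[OF assms])
  have PI: "P (inv P y) = y" for y using bij by (simp add: bij_is_surj surj_f_inv_f)
  have IP: "inv P (P x) = x" for x using bij by (simp add: bij_is_inj)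
  show ?thesis
  proof (rule bounded_linear_intro[where K = "1 / c"])
    show "inv P (x + y) = inv P x + inv P y" for x y
      using IP[of "inv P x + inv P y"] by (simp add: add PI)
    show "inv P (r *\<^sub>R x) = r *\<^sub>R inv P x" for r x
      using IP[of "r *\<^sub>R inv P x"] by (simp add: scaleR PI)
    show "norm (inv P x) \<le> norm x * (1 / c)" for x
      using c(2)[of "inv P x"] c(1) by (simp add: PI field_simps)
  qed
qed

section \<open>Variational inequalities and Lipschitz dependence of the control on the state\<close>

text \<open>Each variational inequality is tested with the other solution. The one for
  \<open>y\<close> triggers pseudomonotonicity of \<open>F\<close>; the one for \<open>z\<close>
  allows \<open>inner (G z) (z - y)\<close>, which is nonpositive, to be subtracted. Cauchy-Schwarz
  concludes.\<close>

lemma strongly_pseudomonotone_on_perturbation: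
  fixes F G :: "'h::real_inner \<Rightarrow> 'h"
  assumes pm: "strongly_pseudomonotone_on m C F"
    and y: "y \<in> C" "\<And>v. v \<in> C \<Longrightarrow> 0 \<le> inner (F y) (v - y)"
    and z: "z \<in> C" "\<And>v. v \<in> C \<Longrightarrow> 0 \<le> inner (G z) (v - z)"
  shows "m * norm (y - z) \<le> norm (F z - G z)"
proof (cases "y = z")
  case False
  have "m * (norm (z - y))\<^sup>2 \<le> inner (F z) (z - y)"
    using pm y z(1) unfolding strongly_pseudomonotone_on_def by blast
  also have "\<dots> \<le> inner (F z - G z) (z - y)"
    using z(2)[OF y(1)] by (simp add: inner_diff_left inner_diff_right)
  also have "\<dots> \<le> norm (F z - G z) * norm (z - y)"
    by (rule norm_cauchy_schwarz)
  finally show ?thesis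
    using False by (simp add: power2_eq_square norm_minus_commute flip: mult.assoc)
qed simp

text \<open>At the common point \<open>P w\<close> the operators for the states \<open>x\<close> and
  \<open>y\<close> differ only through \<open>h\<close>, which gives the factor \<open>a\<close>.
  Pseudomonotonicity contributes \<open>1 / m\<close>, and the return from \<open>P u - P w\<close>
  to \<open>u - w\<close> costs \<open>onorm (inv P)\<close>.\<close>

lemma inclusion_solution_lipschitz:
  fixes P :: "'h::{real_inner, banach} \<Rightarrow> 'h"
  assumes P: "bounded_linear P" "coercive_op P"
    and pm: "strongly_pseudomonotone_on m C (F_op P h t x)"
    and h: "\<And>v. norm (h t x v - h t y v) \<le> a * norm (x - y)"
    and u: "u \<in> (\<lambda>\<xi>. h t x u - \<xi>) ` normal_cone C (P u)"
    and w: "w \<in> (\<lambda>\<xi>. h t y w - \<xi>) ` normal_cone C (P w)"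
  shows "norm (u - w) \<le> a * onorm (inv P) / m * norm (x - y)"
proof -
  have m: "m > 0" using pm by (simp add: strongly_pseudomonotone_on_def)
  have IP: "inv P (P v) = v" for v
    using bij_coercive_op[OF P] by (simp add: bij_is_inj)
  \<comment> \<open>The cone enters the inclusion with a minus sign, so the operator value at
    \<open>P v\<close> is \<open>- \<xi>\<close> and the normal cone inequality is reversed.\<close>
  have vi: "P v \<in> C \<and> (\<forall>k\<in>C. 0 \<le> inner (F_op P h t z (P v)) (k - P v))"
    if v: "v \<in> (\<lambda>\<xi>. h t z v - \<xi>) ` normal_cone C (P v)" for z v
  proof -
    obtain \<xi> where \<xi>: "v = h t z v - \<xi>" "\<xi> \<in> normal_cone C (P v)"
      using v by auto
    have "F_op P h t z (P v) = - \<xi>" using \<xi>(1) by (simp add: F_op_def IP algebra_simps)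
    then show ?thesis using \<xi>(2) by (auto simp: normal_cone_def split: if_splits)
  qed
  have "m * norm (P u - P w) \<le> norm (F_op P h t x (P w) - F_op P h t y (P w))"
    using strongly_pseudomonotone_on_perturbation[OF pm] vi[OF u] vi[OF w] by blast
  also have "\<dots> = norm (h t x w - h t y w)"
    by (simp add: F_op_def IP norm_minus_commute)
  also have "\<dots> \<le> a * norm (x - y)" by (rule h)
  finally have *: "norm (P u - P w) \<le> a * norm (x - y) / m" using m by (simp add: field_simps)
  have inv: "bounded_linear (inv P)" by (rule bounded_linear_inv_coercive_op[OF P])
  have "norm (u - w) = norm (inv P (P u - P w))"
    by (simp add: IP linear_diff[OF bounded_linear.linear[OF inv]])
  also have "\<dots> \<le> onorm (inv P) * norm (P u - P w)" by (rule onorm[OF inv])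
  also have "\<dots> \<le> onorm (inv P) * (a * norm (x - y) / m)"
    by (rule mult_left_mono[OF * onorm_pos_le[OF inv]])
  finally show ?thesis by (simp add: field_simps)
qed

section \<open>From almost every time to every time; measurability of superpositions\<close>

text \<open>Inside the open interval the set where \<open>g\<close> is negative is open and null,
  hence empty. The endpoints follow by continuity.\<close>

lemma continuous_AE_nonneg_on_interval:
  fixes g :: "real \<Rightarrow> real"
  assumes ab: "a < b" and g: "continuous_on {a..b} g"
    and ae: "AE t in lebesgue_on {a<..<b}. 0 \<le> g t"
    and t: "t \<in> {a..b}"
  shows "0 \<le> g t"
proof -
  let ?N = "{t \<in> {a<..<b}. g t < 0}"
  have "AE t in lebesgue. t \<in> {a<..<b} \<longrightarrow> 0 \<le> g t"
    using ae by (subst (asm) AE_restrict_space_iff) auto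
  then have "AE t in lebesgue. t \<notin> ?N" by (rule AE_mp) auto
  then obtain N where "?N \<subseteq> N" "N \<in> null_sets lebesgue"
    by (auto simp: eventually_ae_filter)
  then have "negligible ?N"
    using negligible_iff_null_sets negligible_subset by blast
  moreover have "open ({a<..<b} \<inter> g -` {..<0})"
    using g by (intro continuous_open_preimage) (auto elim: continuous_on_subset)
  then have "open ?N" by (simp add: vimage_def Int_def)
  ultimately have "?N = {}" using open_not_negligible by blast
  then have "0 \<le> g s" if "s \<in> {a<..<b}" for s using that by force
  then show ?thesis
    using continuous_ge_on_closure[of "{a<..<b}" g t 0] g ab t by simp
qed

text \<open>Approximating \<open>g\<close> by simple functions reduces the claim to countably many values of \<open>z\<close>.\<close>

lemma borel_measurable_superposition:
  fixes G :: "'a \<Rightarrow> 'b::{metric_space, second_countable_topology} \<Rightarrow> 'c::metric_space"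
  assumes G: "\<And>z. (\<lambda>s. G s z) \<in> borel_measurable M"
    and cont: "\<And>s. s \<in> space M \<Longrightarrow> continuous_on UNIV (G s)"
    and g: "g \<in> borel_measurable M"
  shows "(\<lambda>s. G s (g s)) \<in> borel_measurable M"
proof -
  \<comment> \<open>\<open>undefined\<close> is an arbitrary reference point; the approximating
    sequence converges for any choice of it.\<close>
  obtain F where F: "\<And>i. simple_function M (F i)"
      "\<And>s. s \<in> space M \<Longrightarrow> (\<lambda>i. F i s) \<longlonglongrightarrow> g s"
    using borel_measurable_implies_sequence_metric[OF g, of undefined] by metis
  show ?thesis
  proof (rule borel_measurable_LIMSEQ_metric)
    \<comment> \<open>\<open>F i\<close> has finitely many values, so this function is pieced
      together from sections \<open>G s z\<close> with \<open>z\<close> fixed.\<close>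
    show "(\<lambda>s. G s (F i s)) \<in> borel_measurable M" for i
    proof (rule measurable_compose_countable'[where I = "F i ` space M"])
      show "(\<lambda>s. G s z) \<in> borel_measurable M" for z by (rule G)
      show "F i \<in> measurable M (count_space (F i ` space M))"
        using F(1)[of i] by (simp add: simple_function_def measurable_count_space_eq2)
      show "countable (F i ` space M)"
        using F(1)[of i] by (simp add: countable_finite simple_functionD(1))
    qed
    show "(\<lambda>i. G s (F i s)) \<longlonglongrightarrow> G s (g s)" if "s \<in> space M" for s
      using cont[OF that]
      by (intro isCont_tendsto_compose[OF _ F(2)[OF that]]) (simp add: continuous_on_eq_continuous_at)
  qed
qed

section \<open>Exponentially bounded strongly continuous semigroups\<close>

text \<open>Values of \<open>S\<close> at negative times are unconstrained, so each use must supply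
  a nonnegative time, such as \<open>t - s\<close> with \<open>s\<close> in
  \<open>{0..t}\<close>.\<close>

locale exp_bounded_C0_semigroup =
  fixes S :: "real \<Rightarrow> 'h::{real_normed_vector, second_countable_topology} \<Rightarrow> 'h"
    and M \<omega> :: real
  assumes C0: "C0_semigroup S"
    and M: "M \<ge> 1"
    and onorm_le: "\<And>t. t \<ge> 0 \<Longrightarrow> onorm (S t) \<le> M * exp (\<omega> * t)"
begin

lemma linear: "t \<ge> 0 \<Longrightarrow> bounded_linear (S t)"
  using C0 by (simp add: C0_semigroup_def)

lemma norm_le:
  assumes "t \<ge> 0"
  shows "norm (S t x) \<le> M * exp (\<omega> * t) * norm x"
  using onorm[OF linear[OF assms], of x] mult_right_mono[OF onorm_le[OF assms] norm_ge_zero[of x]]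
  by linarith

text \<open>Taking the absolute value of \<omega> gives one constant for the whole interval,
  whatever the sign of \<omega>.\<close>

lemma norm_le_uniform:
  assumes "t \<in> {0..b}"
  shows "norm (S t x) \<le> M * exp (\<bar>\<omega>\<bar> * b) * norm x"
proof -
  have "\<omega> * t \<le> \<bar>\<omega>\<bar> * b"
    using assms by (intro mult_mono) auto
  then have "M * exp (\<omega> * t) * norm x \<le> M * exp (\<bar>\<omega>\<bar> * b) * norm x"
    using M by (intro mult_right_mono mult_left_mono) auto
  then show ?thesis using norm_le[of t x] assms by simp
qed

text \<open>Two-sided continuity follows from right continuity at 0: factoring out the earlier of
  two times leaves \<open>x - S (t - s) x\<close>, to which a uniformly bounded operator is
  applied.\<close>

lemma continuous_orbit:
  "continuous_on {0..b} (\<lambda>t. S t x)"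
  unfolding continuous_on_iff
proof (intro ballI allI impI)
  fix t :: real and e :: real
  assume t: "t \<in> {0..b}" and e: "e > 0"
  define C where "C = M * exp (\<bar>\<omega>\<bar> * b)"
  have C: "C > 0" using M by (simp add: C_def)
  have "((\<lambda>t. S t x) \<longlongrightarrow> x) (at_right 0)" using C0 by (simp add: C0_semigroup_def)
  then have "eventually (\<lambda>t. dist (S t x) x < e / C) (at_right 0)"
    using C e by (simp add: tendstoD)
  then obtain d where d: "d > 0" "\<And>r. 0 < r \<Longrightarrow> r < d \<Longrightarrow> dist (S r x) x < e / C"
    unfolding eventually_at_right_field by auto
  have less: "dist (S s x) (S t x) < e" if "0 \<le> s" "s < t" "t \<le> b" "t - s < d" for s t
  proof -
    have "S t x = S s (S (t - s) x)"
    proof -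
      have "S (s + (t - s)) = S s \<circ> S (t - s)"
        using C0 that unfolding C0_semigroup_def by (metis diff_ge_0_iff_ge less_imp_le)
      then show ?thesis by (simp add: fun_eq_iff)
    qed
    then have "dist (S s x) (S t x) = norm (S s (x - S (t - s) x))"
      using that linear[of s] by (simp add: dist_norm linear_diff bounded_linear.linear)
    also have "\<dots> \<le> C * norm (x - S (t - s) x)"
      unfolding C_def using that by (intro norm_le_uniform) auto
    also have "\<dots> < e"
      using d(2)[of "t - s"] that C by (simp add: dist_norm norm_minus_commute field_simps)
    finally show ?thesis .
  qed
  show "\<exists>d>0. \<forall>s\<in>{0..b}. dist s t < d \<longrightarrow> dist (S s x) (S t x) < e"
  proof (intro exI[of _ d] conjI ballI impI)
    fix s assume "s \<in> {0..b}" "dist s t < d"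
    then show "dist (S s x) (S t x) < e"
      using less[of s t] less[of t s] t e
      by (cases s t rule: linorder_cases) (auto simp: dist_real_def dist_commute)
  qed (rule d(1))
qed

end

section \<open>Integrability of the terms in the mild formula\<close>

text \<open>Measurability is superposition: \<open>S (t - s) z\<close> is continuous in
  \<open>s\<close> for fixed \<open>z\<close> and in \<open>z\<close> for fixed \<open>s\<close>.
  The uniform semigroup bound dominates the integrand by a multiple of
  \<open>norm (g s)\<close>.\<close>

lemma integrable_convolution:
  fixes S :: "real \<Rightarrow> 'h::{banach, second_countable_topology} \<Rightarrow> 'h"
  assumes "exp_bounded_C0_semigroup S M \<omega>"
    and g: "integrable (lebesgue_on {0..t}) g"
  shows "integrable (lebesgue_on {0..t}) (\<lambda>s. S (t - s) (g s))"
proof -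
  interpret exp_bounded_C0_semigroup S M \<omega> by fact
  show ?thesis
  proof (rule Bochner_Integration.integrable_bound)
    show "integrable (lebesgue_on {0..t}) (\<lambda>s. M * exp (\<bar>\<omega>\<bar> * t) * norm (g s))"
      using g by simp
    show "(\<lambda>s. S (t - s) (g s)) \<in> borel_measurable (lebesgue_on {0..t})"
    proof (rule borel_measurable_superposition[where G = "\<lambda>s. S (t - s)"])
      show "(\<lambda>s. S (t - s) z) \<in> borel_measurable (lebesgue_on {0..t})" for z
        by (intro continuous_imp_measurable_on_sets_lebesgue
            continuous_on_compose2[OF continuous_orbit[of t z]] continuous_intros) auto
      show "continuous_on UNIV (S (t - s))" if "s \<in> space (lebesgue_on {0..t})" for s
        using that linear[of "t - s"] by (simp add: linear_continuous_on)
      show "g \<in> borel_measurable (lebesgue_on {0..t})" using g by simp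
    qed
    show "AE s in lebesgue_on {0..t}. norm (S (t - s) (g s)) \<le> norm (M * exp (\<bar>\<omega>\<bar> * t) * norm (g s))"
      using M by (intro AE_I2) (auto simp: abs_mult intro!: norm_le_uniform)
  qed
qed

lemma integrable_lebesgue_on_subinterval:
  fixes g :: "real \<Rightarrow> 'h::{banach, second_countable_topology}"
  assumes g: "integrable (lebesgue_on {a..b}) g" and sub: "{c..d} \<subseteq> {a..b}"
  shows "integrable (lebesgue_on {c..d}) g"
proof -
  have "set_integrable lebesgue {a..b} g"
    using g by (simp add: integrable_restrict_space set_integrable_def)
  then have "set_integrable lebesgue {c..d} g"
    by (rule set_integrable_subset[OF _ _ sub]) simp
  then show ?thesis
    by (simp add: integrable_restrict_space set_integrable_def)
qed

text \<open>The Lipschitz bound gives continuity of \<open>f s\<close> at every time, as the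
  superposition lemma requires, and comparison with \<open>f s 0 0\<close> gives an integrable
  majorant.\<close>

lemma integrable_caratheodory_lipschitz:
  fixes f :: "real \<Rightarrow> 'h::{real_inner, banach, second_countable_topology} \<Rightarrow> 'h \<Rightarrow> 'h"
  assumes car: "caratheodory T (\<lambda>t (x, u). f t x u)"
    and lip: "f_lipschitz_assumption T f \<alpha> \<beta>"
    and int0: "integrable (lebesgue_on {0..T}) (\<lambda>t. f t 0 0)"
    and x: "continuous_on {0..T} x" and u: "continuous_on {0..T} u"
  shows "integrable (lebesgue_on {0..T}) (\<lambda>s. f s (x s) (u s))"
proof -
  have f: "norm (f t x\<^sub>1 u\<^sub>1 - f t x\<^sub>2 u\<^sub>2) \<le> \<alpha> * norm (x\<^sub>1 - x\<^sub>2) + \<beta> * norm (u\<^sub>1 - u\<^sub>2)"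
    if "t \<in> {0..T}" for t x\<^sub>1 x\<^sub>2 u\<^sub>1 u\<^sub>2
    using lip that by (auto simp: f_lipschitz_assumption_def)
  have cont: "continuous_on UNIV (\<lambda>z. f s (fst z) (snd z))" if s: "s \<in> {0..T}" for s
    unfolding continuous_on_def
  proof
    fix z :: "'h \<times> 'h"
    have lim: "((\<lambda>w. \<alpha> * norm (fst w - fst z) + \<beta> * norm (snd w - snd z)) \<longlongrightarrow> 0) (at z)"
      by (auto intro!: tendsto_eq_intros)
    have "eventually (\<lambda>w. norm (f s (fst w) (snd w) - f s (fst z) (snd z)) \<le>
        \<alpha> * norm (fst w - fst z) + \<beta> * norm (snd w - snd z)) (at z)"
      by (rule always_eventually) (simp add: f[OF s])
    then have "((\<lambda>w. f s (fst w) (snd w) - f s (fst z) (snd z)) \<longlongrightarrow> 0) (at z)"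
      by (rule Lim_null_comparison[OF _ lim])
    then show "((\<lambda>w. f s (fst w) (snd w)) \<longlongrightarrow> f s (fst z) (snd z)) (at z)"
      using LIM_zero_iff by blast
  qed
  have "(\<lambda>s. f s (fst (x s, u s)) (snd (x s, u s))) \<in> borel_measurable (lebesgue_on {0..T})"
  proof (rule borel_measurable_superposition[where G = "\<lambda>s z. f s (fst z) (snd z)"])
    show "(\<lambda>s. f s (fst z) (snd z)) \<in> borel_measurable (lebesgue_on {0..T})" for z
      using car by (simp add: caratheodory_def case_prod_beta)
    show "(\<lambda>s. (x s, u s)) \<in> borel_measurable (lebesgue_on {0..T})"
      using continuous_on_Pair[OF x u] by (rule continuous_imp_measurable_on_sets_lebesgue) simp
  qed (simp add: cont)
  then have meas: "(\<lambda>s. f s (x s) (u s)) \<in> borel_measurable (lebesgue_on {0..T})" by simp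
  show ?thesis
  proof (rule Bochner_Integration.integrable_bound[OF _ meas])
    show "integrable (lebesgue_on {0..T}) (\<lambda>s. norm (f s 0 0) + (\<alpha> * norm (x s) + \<beta> * norm (u s)))"
      using x u by (intro Bochner_Integration.integrable_add integrable_norm[OF int0]
          continuous_imp_integrable_real continuous_intros)
    have "norm (f s (x s) (u s)) \<le> norm (f s 0 0) + (\<alpha> * norm (x s) + \<beta> * norm (u s))"
      if "s \<in> {0..T}" for s
      using f[OF that, of "x s" "u s" 0 0] norm_triangle_sub[of "f s (x s) (u s)" "f s 0 0"] by simp
    then show "AE s in lebesgue_on {0..T}. norm (f s (x s) (u s)) \<le>
        norm (norm (f s 0 0) + (\<alpha> * norm (x s) + \<beta> * norm (u s)))"
      by (intro AE_I2) (auto intro: order_trans[OF _ abs_ge_self])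
  qed
qed

section \<open>Gronwall's inequality and the maximum norm\<close>

lemma gronwall_integral:
  fixes \<phi> :: "real \<Rightarrow> real"
  assumes cont: "continuous_on {0..T} \<phi>" and b: "b \<ge> 0"
    and le: "\<And>t. t \<in> {0..T} \<Longrightarrow> \<phi> t \<le> a + b * integral {0..t} \<phi>"
    and t: "t \<in> {0..T}"
  shows "\<phi> t \<le> a * exp (b * t)"
proof -
  \<comment> \<open>With this integrating factor the hypothesis says exactly that \<Psi> has
    nonpositive derivative when \<open>b\<close> is positive; moreover \<Psi> starts at
    \<open>a\<close>.\<close>
  define \<Psi> where "\<Psi> s = (a + b * integral {0..s} \<phi>) * exp (- b * s)" for s
  have "\<Psi> t \<le> \<Psi> 0"
  proof (rule DERIV_nonpos_imp_decreasing_open[of 0 t \<Psi>])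
    show "0 \<le> t" using t by simp
    fix s assume s: "0 < s" "s < t"
    have "((\<lambda>s. integral {0..s} \<phi>) has_real_derivative \<phi> s) (at s within {0..T})"
      using cont s t by (intro integral_has_real_derivative) auto
    then have D: "((\<lambda>s. integral {0..s} \<phi>) has_real_derivative \<phi> s) (at s)"
      using s t by (simp add: at_within_Icc_at)
    have "(\<Psi> has_real_derivative b * exp (- b * s) * (\<phi> s - (a + b * integral {0..s} \<phi>))) (at s)"
      unfolding \<Psi>_def by (auto intro!: derivative_eq_intros D simp: algebra_simps)
    moreover have "b * exp (- b * s) * (\<phi> s - (a + b * integral {0..s} \<phi>)) \<le> 0"
      using le[of s] s t b by (intro mult_nonneg_nonpos) auto
    ultimately show "\<exists>y. (\<Psi> has_real_derivative y) (at s) \<and> y \<le> 0" by blast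
  next
    have "continuous_on {0..t} \<phi>" using cont by (rule continuous_on_subset) (use t in auto)
    then show "continuous_on {0..t} \<Psi>"
      unfolding \<Psi>_def
      by (intro continuous_intros indefinite_integral_continuous_1 integrable_continuous_interval)
  qed
  then have "(a + b * integral {0..t} \<phi>) * exp (- b * t) \<le> a" by (simp add: \<Psi>_def)
  then have "a + b * integral {0..t} \<phi> \<le> a * exp (b * t)"
    by (simp add: exp_minus field_simps)
  then show ?thesis using le[OF t] by simp
qed

text \<open>By compactness of the nonempty interval the maximum is attained, so
  \<open>GREATEST\<close> denotes an actual value of the norm.\<close>

lemma C_norm_le:
  fixes v :: "real \<Rightarrow> 'h::real_normed_vector"
  assumes T: "T \<ge> 0" and v: "continuous_on {0..T} v"
    and le: "\<And>t. t \<in> {0..T} \<Longrightarrow> norm (v t) \<le> B"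
  shows "C_norm T v \<le> B"
proof -
  have "continuous_on {0..T} (\<lambda>t. norm (v t))" using v by (intro continuous_intros)
  then obtain t where t: "t \<in> {0..T}" "\<And>s. s \<in> {0..T} \<Longrightarrow> norm (v s) \<le> norm (v t)"
    using continuous_attains_sup[of "{0..T}" "\<lambda>t. norm (v t)"] T by auto
  have "C_norm T v = norm (v t)"
    unfolding C_norm_def using t by (intro Greatest_equality) auto
  then show ?thesis using le[OF t(1)] by simp
qed

section \<open>Stability of mild solution pairs with respect to the initial datum\<close>

theorem theorem5p2:
  fixes T :: real
    and A :: "'h::{real_inner, banach, second_countable_topology} \<Rightarrow> 'h"
    and D :: "'h set"
    and S :: "real \<Rightarrow> 'h \<Rightarrow> 'h"
    and P :: "'h \<Rightarrow> 'h"
    and K :: "real \<Rightarrow> 'h set"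
    and f h :: "real \<Rightarrow> 'h \<Rightarrow> 'h \<Rightarrow> 'h"
    and \<gamma> L\<^sub>F \<alpha>\<^sub>h \<alpha>\<^sub>f \<beta>\<^sub>f M \<omega> L L' :: real
    and x\<^sub>0\<^sub>1 x\<^sub>0\<^sub>2 :: 'h
    and x\<^sub>1 u\<^sub>1 x\<^sub>2 u\<^sub>2 :: "real \<Rightarrow> 'h"
  assumes "T > 0"
    and "standing_assumption T A D S P K f h"
    and "strong_pseudomonotonicity_assumption T P K h \<gamma> L\<^sub>F"
    and "state_lipschitz_assumption T h \<alpha>\<^sub>h"
    and "time_regularity_assumption T K h"
    and "f_lipschitz_assumption T f \<alpha>\<^sub>f \<beta>\<^sub>f"
    and "mild_solution_pair T S P K f h x\<^sub>0\<^sub>1 x\<^sub>1 u\<^sub>1"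
    and "mild_solution_pair T S P K f h x\<^sub>0\<^sub>2 x\<^sub>2 u\<^sub>2"
    and "M \<ge> 1"
    and "\<And>t. t \<ge> 0 \<Longrightarrow> onorm (S t) \<le> M * exp (\<omega> * t)"
    and "L = \<alpha>\<^sub>h * onorm (inv P) / \<gamma>"
    and "L' = \<alpha>\<^sub>f + \<beta>\<^sub>f * L"
  shows "(\<forall>t\<in>{0..T}.
            norm (x\<^sub>1 t - x\<^sub>2 t) \<le> M * exp ((\<omega> + M * L') * t) * norm (x\<^sub>0\<^sub>1 - x\<^sub>0\<^sub>2) \<and>
            norm (u\<^sub>1 t - u\<^sub>2 t) \<le> L * M * exp ((\<omega> + M * L') * t) * norm (x\<^sub>0\<^sub>1 - x\<^sub>0\<^sub>2)) \<and>
         C_norm T (\<lambda>t. x\<^sub>1 t - x\<^sub>2 t)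
           \<le> M * exp (max (\<omega> + M * L') 0 * T) * norm (x\<^sub>0\<^sub>1 - x\<^sub>0\<^sub>2) \<and>
         C_norm T (\<lambda>t. u\<^sub>1 t - u\<^sub>2 t)
           \<le> L * M * exp (max (\<omega> + M * L') 0 * T) * norm (x\<^sub>0\<^sub>1 - x\<^sub>0\<^sub>2)"
proof -
  note standing = assms(2)[unfolded standing_assumption_def generates_C0_semigroup_def]
  note lip_f = assms(6)[unfolded f_lipschitz_assumption_def]
  have P: "bounded_linear P" "coercive_op P" using standing by auto
  have pm: "strongly_pseudomonotone_on \<gamma> (K t) (F_op P h t x)" if "t \<in> {0..T}" for t x
    using assms(3) that by (simp add: strong_pseudomonotonicity_assumption_def)
  have lip_h: "norm (h t x v - h t y v) \<le> \<alpha>\<^sub>h * norm (x - y)" if "t \<in> {0..T}" for t x y v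
    using assms(4) that by (simp add: state_lipschitz_assumption_def)
  note mild = assms(7,8)[unfolded mild_solution_pair_def]
  have cont: "continuous_on {0..T} x\<^sub>1" "continuous_on {0..T} u\<^sub>1"
      "continuous_on {0..T} x\<^sub>2" "continuous_on {0..T} u\<^sub>2"
    using mild by auto
  interpret exp_bounded_C0_semigroup S M \<omega>
    using standing assms(9,10) by unfold_locales auto
  have L: "L \<ge> 0"
    using assms(3,4) onorm_pos_le[OF bounded_linear_inv_coercive_op[OF P]] unfolding assms(11)
    by (simp add: strong_pseudomonotonicity_assumption_def state_lipschitz_assumption_def)
  have L': "L' \<ge> 0" using L lip_f unfolding assms(12) by simp

  have u_le: "norm (u\<^sub>1 t - u\<^sub>2 t) \<le> L * norm (x\<^sub>1 t - x\<^sub>2 t)" if t: "t \<in> {0..T}" for t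
  proof -
    have "0 \<le> L * norm (x\<^sub>1 t - x\<^sub>2 t) - norm (u\<^sub>1 t - u\<^sub>2 t)"
    proof (rule continuous_AE_nonneg_on_interval[OF assms(1) _ _ t])
      show "continuous_on {0..T} (\<lambda>t. L * norm (x\<^sub>1 t - x\<^sub>2 t) - norm (u\<^sub>1 t - u\<^sub>2 t))"
        using cont by (intro continuous_intros)
      \<comment> \<open>The assumptions on \<open>h\<close> and \<open>K\<close> hold only for times
        in \<open>{0..T}\<close>, so membership is carried along with the two inclusions.\<close>
      have "AE t in lebesgue_on {0<..<T}. t \<in> {0<..<T}"
        using AE_space[of "lebesgue_on {0<..<T}"] by simp
      moreover have "AE t in lebesgue_on {0<..<T}.
          u\<^sub>1 t \<in> (\<lambda>\<xi>. h t (x\<^sub>1 t) (u\<^sub>1 t) - \<xi>) ` normal_cone (K t) (P (u\<^sub>1 t))"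
        using mild by blast
      moreover have "AE t in lebesgue_on {0<..<T}.
          u\<^sub>2 t \<in> (\<lambda>\<xi>. h t (x\<^sub>2 t) (u\<^sub>2 t) - \<xi>) ` normal_cone (K t) (P (u\<^sub>2 t))"
        using mild by blast
      ultimately show "AE t in lebesgue_on {0<..<T}.
          0 \<le> L * norm (x\<^sub>1 t - x\<^sub>2 t) - norm (u\<^sub>1 t - u\<^sub>2 t)"
      proof eventually_elim
        case (elim t)
        then have "t \<in> {0..T}" by auto
        then show ?case
          using inclusion_solution_lipschitz[OF P pm lip_h elim(2,3)] by (simp add: assms(11))
      qed
    qed
    then show ?thesis by simp
  qed

  \<comment> \<open>Integrability excludes the default value of the Bochner integral, so the two
    convolution terms can be subtracted under one integral sign.\<close>
  have int_f: "integrable (lebesgue_on {0..t}) (\<lambda>s. f s (x s) (u s))"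
    if "continuous_on {0..T} x" "continuous_on {0..T} u" "t \<in> {0..T}" for x u t
    by (rule integrable_lebesgue_on_subinterval[OF integrable_caratheodory_lipschitz[OF _ assms(6) _ that(1,2)]])
       (use standing that(3) in auto)

  \<comment> \<open>The weight absorbs the semigroup growth: the kernel of the integral inequality
    becomes the constant \<open>M * L'\<close>, for either sign of \<omega>.\<close>
  define \<phi> where "\<phi> t = exp (- \<omega> * t) * norm (x\<^sub>1 t - x\<^sub>2 t)" for t
  define d where "d = norm (x\<^sub>0\<^sub>1 - x\<^sub>0\<^sub>2)"
  have cont_\<phi>: "continuous_on {0..T} \<phi>"
    unfolding \<phi>_def using cont by (intro continuous_intros)
  have \<phi>_le: "\<phi> t \<le> M * d + M * L' * integral {0..t} \<phi>" if t: "t \<in> {0..T}" for t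
  proof -
    define g where "g s = f s (x\<^sub>1 s) (u\<^sub>1 s) - f s (x\<^sub>2 s) (u\<^sub>2 s)" for s
    have "continuous_on {0..t} \<phi>" using cont_\<phi> by (rule continuous_on_subset) (use t in auto)
    then have int_\<phi>: "integrable (lebesgue_on {0..t}) \<phi>"
      by (rule continuous_imp_integrable_real)
    have int_g: "integrable (lebesgue_on {0..t}) (\<lambda>s. S (t - s) (g s))"
      unfolding g_def using int_f[OF cont(1,2) t] int_f[OF cont(3,4) t]
      by (intro integrable_convolution[OF exp_bounded_C0_semigroup_axioms] Bochner_Integration.integrable_diff)
    have "x\<^sub>1 t - x\<^sub>2 t = S t x\<^sub>0\<^sub>1 - S t x\<^sub>0\<^sub>2 +
        ((LINT s|lebesgue_on {0..t}. S (t - s) (f s (x\<^sub>1 s) (u\<^sub>1 s))) -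
         (LINT s|lebesgue_on {0..t}. S (t - s) (f s (x\<^sub>2 s) (u\<^sub>2 s))))"
      using mild t by (simp add: algebra_simps)
    also have "S t x\<^sub>0\<^sub>1 - S t x\<^sub>0\<^sub>2 = S t (x\<^sub>0\<^sub>1 - x\<^sub>0\<^sub>2)"
      using linear[of t] t by (simp add: linear_diff bounded_linear.linear)
    also have "(LINT s|lebesgue_on {0..t}. S (t - s) (f s (x\<^sub>1 s) (u\<^sub>1 s))) -
         (LINT s|lebesgue_on {0..t}. S (t - s) (f s (x\<^sub>2 s) (u\<^sub>2 s))) =
         (LINT s|lebesgue_on {0..t}. S (t - s) (f s (x\<^sub>1 s) (u\<^sub>1 s)) - S (t - s) (f s (x\<^sub>2 s) (u\<^sub>2 s)))"
      by (rule Bochner_Integration.integral_diff[symmetric];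
          rule integrable_convolution[OF exp_bounded_C0_semigroup_axioms]; rule int_f; fact)
    also have "\<dots> = (LINT s|lebesgue_on {0..t}. S (t - s) (g s))"
      by (rule Bochner_Integration.integral_cong)
         (auto simp: g_def linear_diff[OF bounded_linear.linear[OF linear]])
    finally have "norm (x\<^sub>1 t - x\<^sub>2 t) \<le>
        norm (S t (x\<^sub>0\<^sub>1 - x\<^sub>0\<^sub>2)) + norm (LINT s|lebesgue_on {0..t}. S (t - s) (g s))"
      by (simp add: norm_triangle_ineq)
    also have "norm (LINT s|lebesgue_on {0..t}. S (t - s) (g s)) \<le>
        (LINT s|lebesgue_on {0..t}. exp (\<omega> * t) * (M * L') * \<phi> s)"
    proof (rule Bochner_Integration.integral_norm_bound_integral[OF int_g])
      show "integrable (lebesgue_on {0..t}) (\<lambda>s. exp (\<omega> * t) * (M * L') * \<phi> s)"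
        using int_\<phi> by simp
      fix s assume "s \<in> space (lebesgue_on {0..t})"
      then have s: "s \<in> {0..T}" "0 \<le> t - s" using t by auto
      have "norm (g s) \<le> \<alpha>\<^sub>f * norm (x\<^sub>1 s - x\<^sub>2 s) + \<beta>\<^sub>f * norm (u\<^sub>1 s - u\<^sub>2 s)"
        using lip_f s by (simp add: g_def)
      \<comment> \<open>Eliminating the controls through \<open>u_le\<close> produces the constant
        \<open>L'\<close>.\<close>
      also have "\<dots> \<le> \<alpha>\<^sub>f * norm (x\<^sub>1 s - x\<^sub>2 s) + \<beta>\<^sub>f * (L * norm (x\<^sub>1 s - x\<^sub>2 s))"
        using lip_f by (intro add_left_mono mult_left_mono u_le[OF s(1)]) simp
      also have "\<dots> = L' * norm (x\<^sub>1 s - x\<^sub>2 s)" by (simp add: assms(12) algebra_simps)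
      finally have "M * exp (\<omega> * (t - s)) * norm (g s) \<le>
          M * exp (\<omega> * (t - s)) * (L' * norm (x\<^sub>1 s - x\<^sub>2 s))"
        using M by (intro mult_left_mono) auto
      from order_trans[OF norm_le[OF s(2)] this]
      have "norm (S (t - s) (g s)) \<le> M * exp (\<omega> * (t - s)) * (L' * norm (x\<^sub>1 s - x\<^sub>2 s))" .
      also have "exp (\<omega> * (t - s)) = exp (\<omega> * t) * exp (- \<omega> * s)"
        by (simp add: algebra_simps flip: exp_add)
      finally show "norm (S (t - s) (g s)) \<le> exp (\<omega> * t) * (M * L') * \<phi> s"
        by (simp add: \<phi>_def mult_ac)
    qed
    \<comment> \<open>Here the Bochner integral is replaced by the gauge integral in which
      Gronwall's inequality is stated.\<close>
    also have "\<dots> = exp (\<omega> * t) * (M * L') * integral {0..t} \<phi>"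
      using int_\<phi> by (simp add: lebesgue_integral_eq_integral)
    finally have "norm (x\<^sub>1 t - x\<^sub>2 t) \<le> exp (\<omega> * t) * (M * d + M * L' * integral {0..t} \<phi>)"
      using norm_le[of t "x\<^sub>0\<^sub>1 - x\<^sub>0\<^sub>2"] t by (simp add: d_def algebra_simps)
    then show ?thesis by (simp add: \<phi>_def exp_minus field_simps)
  qed

  have x_le: "norm (x\<^sub>1 t - x\<^sub>2 t) \<le> M * exp ((\<omega> + M * L') * t) * d" if t: "t \<in> {0..T}" for t
  proof -
    \<comment> \<open>Gronwall with \<open>a = M * d\<close> and \<open>b = M * L'\<close>;
      multiplying by \<open>exp (\<omega> * t)\<close> then undoes the weight.\<close>
    have "\<phi> t \<le> M * d * exp (M * L' * t)"
      using M L' by (intro gronwall_integral[OF cont_\<phi> _ \<phi>_le t]) auto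
    then show ?thesis
      by (simp add: \<phi>_def exp_minus exp_add distrib_right field_simps)
  qed
  have u_le': "norm (u\<^sub>1 t - u\<^sub>2 t) \<le> L * M * exp ((\<omega> + M * L') * t) * d"
    if t: "t \<in> {0..T}" for t
    using order_trans[OF u_le[OF t] mult_left_mono[OF x_le[OF t] L]] by (simp add: mult.assoc)
  \<comment> \<open>If the growth rate is negative the exponential is largest at time 0, not at
    \<open>T\<close>; hence the positive part.\<close>
  have exp_le: "exp ((\<omega> + M * L') * t) \<le> exp (max (\<omega> + M * L') 0 * T)" if "t \<in> {0..T}" for t
    using that by (auto intro!: mult_mono)
  have "C_norm T (\<lambda>t. x\<^sub>1 t - x\<^sub>2 t) \<le> M * exp (max (\<omega> + M * L') 0 * T) * d"
  proof (rule C_norm_le)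
    show "norm (x\<^sub>1 t - x\<^sub>2 t) \<le> M * exp (max (\<omega> + M * L') 0 * T) * d" if "t \<in> {0..T}" for t
      using exp_le[OF that] M
      by (intro order_trans[OF x_le[OF that]] mult_right_mono mult_left_mono) (auto simp: d_def)
  qed (use assms(1) cont in \<open>auto intro: continuous_intros\<close>)
  moreover have "C_norm T (\<lambda>t. u\<^sub>1 t - u\<^sub>2 t) \<le> L * M * exp (max (\<omega> + M * L') 0 * T) * d"
  proof (rule C_norm_le)
    show "norm (u\<^sub>1 t - u\<^sub>2 t) \<le> L * M * exp (max (\<omega> + M * L') 0 * T) * d" if "t \<in> {0..T}" for t
      using exp_le[OF that] M L
      by (intro order_trans[OF u_le'[OF that]] mult_right_mono mult_left_mono) (auto simp: d_def)
  qed (use assms(1) cont in \<open>auto intro: continuous_intros\<close>)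
  ultimately show ?thesis using x_le u_le' unfolding d_def by blast
qed

end
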